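(* Let $\sim$ be an equivalence relation on permutations (that is, on each symmetric group $\mathfrak S_n$), let $\mathrm a$ be one of the operations $\mathrm r$ (reverse), $\mathrm c$ (complement), $\mathrm i$ (inverse), or a composition of them, and let $\mathbf p$ be a bivincular pattern. (1) Assume that for any permutations $\pi,\mu$, $\pi^{\mathrm a}\sim\mu^{\mathrm a}$ implies $\pi\sim\mu$. Then the maps $\mathrm a\colon \widetilde{\mathfrak A}_n(\mathbf p)\to\widetilde{\mathfrak A}_n(\mathbf p^{\mathrm a})$ and $\mathrm a\colon \widetilde{\mathfrak M}_n(\mathbf p)\to\widetilde{\mathfrak M}_n(\mathbf p^{\mathrm a})$, $\pi\mapsto\pi^{\mathrm a}$, are (well-defined) injections. (2) Assume that for any permutations $\pi,\mu$, $\pi\sim\mu$ implies $\pi^{\mathrm a}\sim\mu^{\mathrm a}$. Then the maps $\mathrm a^{-1}\colon \widetilde{\mathfrak A}_n(\mathbf p^{\mathrm a})\to\widetilde{\mathfrak A}_n(\mathbf p)$ and $\mathrm a^{-1}\colon \widetilde{\mathfrak M}_n(\mathbf p^{\mathrm a})\to\widetilde{\mathfrak M}_n(\mathbf p)$ are (well-defined) injections. (3) Assume that for any permutations $\pi,\mu$, $\pi\sim\mu$ if and only if $\pi^{\mathrm a}\sim\mu^{\mathrm a}$. Then the maps $\mathrm a\colon \widetilde{\mathfrak A}_n(\mathbf p)\to\widetilde{\mathfrak A}_n(\mathbf p^{\mathrm a})$ and $\mathrm a\colon \widetilde{\mathfrak M}_n(\mathbf p)\to\widetilde{\mathfrak M}_n(\mathbf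 p^{\mathrm a})$ are bijections.
   Context: Permutations in $\mathfrak S_n$ are written in one-line notation $\pi=\pi_1\cdots\pi_n$. A bivincular pattern is a triple $(p,X,Y)$ with $p\in\mathfrak S_k$ and $X,Y\subseteq\{0,1,\dots,k\}$. An occurrence of $(p,X,Y)$ in $\pi\in\mathfrak S_n$ is a subsequence $\pi_{i_1}\cdots\pi_{i_k}$ ($i_1<\cdots<i_k$) whose letters are in the same relative order as the letters of $p$, such that $i_{x+1}=i_x+1$ for all $x\in X$, and $j_{y+1}=j_y+1$ for all $y\in Y$, where $\{\pi_{i_1},\dots,\pi_{i_k}\}=\{j_1<\cdots<j_k\}$ and by convention $i_0=j_0=0$, $i_{k+1}=j_{k+1}=n+1$. A permutation matches a pattern if it has an occurrence of it, and avoids it otherwise. Given an equivalence relation $\sim$ on permutations, $\widetilde{\mathfrak A}_n(\mathbf p)$ is the set of $\pi\in\mathfrak S_n$ such that $\pi$ and every permutation equivalent to $\pi$ avoids $\mathbf p$; $\widetilde{\mathfrak M}_n(\mathbf p)$ is the set of $\pi\in\mathfrak S_n$ such that $\pi$ and every permutation equivalent to $\pi$ matches $\mathbf p$. For a permutation, $\pi^{\mathrm r}$ is the reverse ($\pi$ read backwards), $\pi^{\mathrm c}$ the complement (each letter $\pi_j$ replaced by $n+1-\pi_j$), $\pi^{\mathrm i}$ the inverse. For a pattern with $p\in\mathfrak S_k$: $(p,X,Y)^{\mathrm r}=(p^{\mathrm r},k-X,Y)$, $(p,X,Y)^{\mathrm c}=(p^{\mathrm c},X,k-Y)$, $(p,X,Y)^{\mathrm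 i}=(p^{\mathrm i},Y,X)$, where $k-M=\{k-m: m\in M\}$. For a composition of operations, the operations are applied successively in the same order to permutations and to patterns. *)

theory Defs
  imports Main "HOL-Combinatorics.Permutations"
begin

text \<open>
  A permutation of size \<open>n\<close> is a function permuting \<open>{1..n}\<close>; its one-line notation
  is \<open>\<pi> 1, \<dots>, \<pi> n\<close>. Such a function does not determine \<open>n\<close>, so the size is passed
  explicitly throughout.
\<close>

definition perms :: "nat \<Rightarrow> (nat \<Rightarrow> nat) set" where
  "perms n = {\<pi>. \<pi> permutes {1..n}}"

definition perm_rev :: "nat \<Rightarrow> (nat \<Rightarrow> nat) \<Rightarrow> nat \<Rightarrow> nat" where
  "perm_rev n \<pi> = (\<lambda>t. if t \<in> {1..n} then \<pi> (n + 1 - t) else t)"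

definition perm_compl :: "nat \<Rightarrow> (nat \<Rightarrow> nat) \<Rightarrow> nat \<Rightarrow> nat" where
  "perm_compl n \<pi> = (\<lambda>t. if t \<in> {1..n} then n + 1 - \<pi> t else t)"

type_synonym pattern = "(nat \<Rightarrow> nat) \<times> nat set \<times> nat set"

fun bivincular_pattern :: "nat \<Rightarrow> pattern \<Rightarrow> bool" where
  "bivincular_pattern k (p, X, Y) \<longleftrightarrow> p \<in> perms k \<and> X \<subseteq> {0..k} \<and> Y \<subseteq> {0..k}"

text \<open>
  The positions \<open>i\<close> and the increasingly sorted letters \<open>j\<close> of an occurrence are extended
  by the boundary values \<open>0\<close> and \<open>n + 1\<close>. Strict monotonicity on \<open>{0..k+1}\<close> then forces
  \<open>i\<close> and \<open>j\<close> to map \<open>{1..k}\<close> into \<open>{1..n}\<close>.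
\<close>

fun occurrence :: "nat \<Rightarrow> nat \<Rightarrow> pattern \<Rightarrow> (nat \<Rightarrow> nat) \<Rightarrow> (nat \<Rightarrow> nat) \<Rightarrow> bool" where
  "occurrence n k (p, X, Y) \<pi> i \<longleftrightarrow>
     strict_mono_on {0..k+1} i \<and> i 0 = 0 \<and> i (k + 1) = n + 1 \<and>
     (\<forall>s\<in>{1..k}. \<forall>t\<in>{1..k}. \<pi> (i s) < \<pi> (i t) \<longleftrightarrow> p s < p t) \<and>
     (\<forall>x\<in>X. i (x + 1) = i x + 1) \<and>
     (\<exists>j. strict_mono_on {0..k+1} j \<and> j 0 = 0 \<and> j (k + 1) = n + 1 \<and>
          (\<lambda>t. \<pi> (i t)) ` {1..k} = j ` {1..k} \<and>
          (\<forall>y\<in>Y. j (y + 1) = j y + 1))"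

definition matches :: "nat \<Rightarrow> nat \<Rightarrow> pattern \<Rightarrow> (nat \<Rightarrow> nat) \<Rightarrow> bool" where
  "matches n k P \<pi> \<longleftrightarrow> (\<exists>i. occurrence n k P \<pi> i)"

definition avoids :: "nat \<Rightarrow> nat \<Rightarrow> pattern \<Rightarrow> (nat \<Rightarrow> nat) \<Rightarrow> bool" where
  "avoids n k P \<pi> \<longleftrightarrow> \<not> matches n k P \<pi>"

text \<open>An equivalence relation on permutations is a family with one relation for each size.\<close>

type_synonym perm_rel = "nat \<Rightarrow> ((nat \<Rightarrow> nat) \<times> (nat \<Rightarrow> nat)) set"

definition avoid_class :: "perm_rel \<Rightarrow> nat \<Rightarrow> nat \<Rightarrow> pattern \<Rightarrow> (nat \<Rightarrow> nat) set" where
  "avoid_class R n k P =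
     {\<pi> \<in> perms n. avoids n k P \<pi> \<and> (\<forall>\<sigma>\<in>perms n. (\<pi>, \<sigma>) \<in> R n \<longrightarrow> avoids n k P \<sigma>)}"

definition match_class :: "perm_rel \<Rightarrow> nat \<Rightarrow> nat \<Rightarrow> pattern \<Rightarrow> (nat \<Rightarrow> nat) set" where
  "match_class R n k P =
     {\<pi> \<in> perms n. matches n k P \<pi> \<and> (\<forall>\<sigma>\<in>perms n. (\<pi>, \<sigma>) \<in> R n \<longrightarrow> matches n k P \<sigma>)}"

datatype symmetry = Reverse | Complement | Inverse

fun sym_perm :: "nat \<Rightarrow> symmetry \<Rightarrow> (nat \<Rightarrow> nat) \<Rightarrow> (nat \<Rightarrow> nat)" where
  "sym_perm n Reverse \<pi> = perm_rev n \<pi>"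
| "sym_perm n Complement \<pi> = perm_compl n \<pi>"
| "sym_perm n Inverse \<pi> = inv \<pi>"

fun sym_pattern :: "nat \<Rightarrow> symmetry \<Rightarrow> pattern \<Rightarrow> pattern" where
  "sym_pattern k Reverse (p, X, Y) = (perm_rev k p, (\<lambda>m. k - m) ` X, Y)"
| "sym_pattern k Complement (p, X, Y) = (perm_compl k p, X, (\<lambda>m. k - m) ` Y)"
| "sym_pattern k Inverse (p, X, Y) = (inv p, Y, X)"

text \<open>A composition is a list of operations, whose first element is applied first.\<close>

definition op_perm :: "symmetry list \<Rightarrow> nat \<Rightarrow> (nat \<Rightarrow> nat) \<Rightarrow> (nat \<Rightarrow> nat)" where
  "op_perm a n = fold (sym_perm n) a"

definition op_pattern :: "symmetry list \<Rightarrow> nat \<Rightarrow> pattern \<Rightarrow> pattern" where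
  "op_pattern a k = fold (sym_pattern k) a"

end

theory Submission
  imports Defs
begin

text \<open>
  If \<open>i\<close> and \<open>j\<close> enumerate the positions and the letters of an occurrence in increasing order,
  then the occurrence condition is just \<open>\<pi> (i t) = j (p t)\<close>. In this form inversion swaps
  \<open>i\<close> with \<open>j\<close>, while reversal and complement replace \<open>i\<close>, respectively \<open>j\<close>, by the enumeration
  \<open>t \<mapsto> n + 1 - i (k + 1 - t)\<close>. Hence every symmetry preserves matching. Together with its
  bijectivity on permutations this transports the avoidance and matching classes.
\<close>

section \<open>Enumerations with boundary values and prescribed adjacencies\<close>

text \<open>An occurrence constrains positions and sorted letters in the same way. This shared form
  lets inversion exchange them.\<close>

definition gap_enum :: "nat \<Rightarrow> nat \<Rightarrow> nat set \<Rightarrow> (nat \<Rightarrow> nat) \<Rightarrow> bool" where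
  "gap_enum n k X i \<longleftrightarrow> strict_mono_on {0..k+1} i \<and> i 0 = 0 \<and> i (k + 1) = n + 1 \<and>
     (\<forall>x\<in>X. i (x + 1) = i x + 1)"

lemma gap_enum_less:
  assumes "gap_enum n k X i" "s < t" "t \<le> k + 1"
  shows "i s < i t"
  using assms unfolding gap_enum_def by (auto intro: strict_mono_onD)

lemma gap_enum_less_iff:
  assumes "gap_enum n k X i" "s \<le> k + 1" "t \<le> k + 1"
  shows "i s < i t \<longleftrightarrow> s < t"
  using gap_enum_less[OF assms(1), of s t] gap_enum_less[OF assms(1), of t s] assms(2,3)
  by (cases s t rule: linorder_cases) auto

lemma gap_enum_in_range:
  assumes "gap_enum n k X i" "t \<in> {1..k}"
  shows "i t \<in> {1..n}"
  using gap_enum_less[OF assms(1), of 0 t] gap_enum_less[OF assms(1), of t "k + 1"] assms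
  by (auto simp: gap_enum_def)

text \<open>Reflecting both index and value preserves monotonicity and exchanges the two boundary
  values. The step from \<open>x\<close> to \<open>x + 1\<close> becomes the step from
  \<open>k - x\<close> to \<open>k - x + 1\<close>.\<close>

lemma gap_enum_flip:
  assumes i: "gap_enum n k X i" and X: "X \<subseteq> {0..k}"
  shows "gap_enum n k ((\<lambda>m. k - m) ` X) (\<lambda>t. n + 1 - i (k + 1 - t))"
proof -
  \<comment> \<open>With this bound the truncated subtractions from \<open>n + 1\<close> stay
    positive, so strictness and unit steps survive.\<close>
  have bound: "i t \<le> n" if "t \<le> k" for t
    using gap_enum_less[OF i, of t "k + 1"] i that by (simp add: gap_enum_def)
  have "strict_mono_on {0..k+1} (\<lambda>t. n + 1 - i (k + 1 - t))"
  proof (rule strict_mono_onI)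
    fix r s assume rs: "r \<in> {0..k+1}" "s \<in> {0..k+1}" "r < s"
    then have "i (k + 1 - s) < i (k + 1 - r)"
      by (intro gap_enum_less[OF i]) auto
    moreover have "i (k + 1 - s) \<le> n"
      using rs by (intro bound) auto
    ultimately show "n + 1 - i (k + 1 - r) < n + 1 - i (k + 1 - s)"
      by linarith
  qed
  moreover have "n + 1 - i (k + 1 - (k - x + 1)) = n + 1 - i (k + 1 - (k - x)) + 1" if "x \<in> X" for x
  proof -
    have "x \<le> k" "i (x + 1) = i x + 1"
      using that X i by (auto simp: gap_enum_def)
    moreover from this have "k + 1 - (k - x + 1) = x" "k + 1 - (k - x) = x + 1"
      by auto
    ultimately show ?thesis
      using bound[of x] by (simp del: diff_Suc_Suc)
  qed
  ultimately show ?thesis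
    using i by (auto simp: gap_enum_def)
qed

text \<open>Well-founded induction: if the functions agree below \<open>x\<close>, the value of one
  at \<open>x\<close> is taken by the other at some \<open>y\<close> not below \<open>x\<close>.
  This gives an inequality, and by symmetry equality.\<close>

lemma strict_mono_on_image_eqD:
  fixes f g :: "'a::wellorder \<Rightarrow> 'b::linorder"
  assumes f: "strict_mono_on A f" and g: "strict_mono_on A g" and img: "f ` A = g ` A"
    and "x \<in> A"
  shows "f x = g x"
  using \<open>x \<in> A\<close>
proof (induction x rule: less_induct)
  case (less x)
  have ge: "v x \<le> u x" if u: "strict_mono_on A u" and v: "strict_mono_on A v" and "u ` A = v ` A"
    and IH: "\<And>y. y < x \<Longrightarrow> y \<in> A \<Longrightarrow> u y = v y" for u v :: "'a \<Rightarrow> 'b"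
  proof -
    obtain y where y: "y \<in> A" "u x = v y"
      using \<open>u ` A = v ` A\<close> less.prems by (metis imageE imageI)
    \<comment> \<open>Otherwise the induction hypothesis gives \<open>u y = v y = u x\<close>,
      against strictness of \<open>u\<close>.\<close>
    have "\<not> y < x"
      using y IH[of y] strict_mono_onD[OF u y(1) less.prems] by auto
    then show ?thesis
      using y strict_mono_onD[OF v less.prems y(1)] by (cases x y rule: linorder_cases) auto
  qed
  show ?case
    using ge[OF f g img] ge[OF g f img[symmetric]] less.IH by (metis antisym)
qed

section \<open>Matching as an equation between enumerations\<close>

lemma occurrence_iff_gap_enum:
  "occurrence n k (p, X, Y) \<pi> i \<longleftrightarrow>
    gap_enum n k X i \<and>
    (\<forall>s\<in>{1..k}. \<forall>t\<in>{1..k}. \<pi> (i s) < \<pi> (i t) \<longleftrightarrow> p s < p t) \<and>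
    (\<exists>j. gap_enum n k Y j \<and> (\<lambda>t. \<pi> (i t)) ` {1..k} = j ` {1..k})"
  unfolding occurrence.simps gap_enum_def by (simp only: conj_ac)

text \<open>Order isomorphism with \<open>p\<close> means that the letters, read through
  \<open>inv p\<close>, increase. They have the same image as \<open>j\<close>, so they equal
  \<open>j\<close>. Conversely, monotonicity of \<open>j\<close> returns the order condition and
  bijectivity of \<open>p\<close> the image condition.\<close>

lemma matches_iff:
  assumes "p permutes {1..k}"
  shows "matches n k (p, X, Y) \<pi> \<longleftrightarrow>
    (\<exists>i j. gap_enum n k X i \<and> gap_enum n k Y j \<and> (\<forall>t\<in>{1..k}. \<pi> (i t) = j (p t)))"
proof
  assume "matches n k (p, X, Y) \<pi>"
  then obtain i j where i: "gap_enum n k X i" and j: "gap_enum n k Y j"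
    and ord: "\<forall>s\<in>{1..k}. \<forall>t\<in>{1..k}. \<pi> (i s) < \<pi> (i t) \<longleftrightarrow> p s < p t"
    and img: "(\<lambda>t. \<pi> (i t)) ` {1..k} = j ` {1..k}"
    unfolding matches_def occurrence_iff_gap_enum by blast
  let ?q = "inv p"
  have q: "?q permutes {1..k}"
    using assms by (rule permutes_inv)
  have "strict_mono_on {1..k} (\<lambda>s. \<pi> (i (?q s)))"
  proof (rule strict_mono_onI)
    fix r s assume rs: "r \<in> {1..k}" "s \<in> {1..k}" "r < s"
    then have "?q r \<in> {1..k}" "?q s \<in> {1..k}"
      unfolding permutes_in_image[OF q] by auto
    then have "\<pi> (i (?q r)) < \<pi> (i (?q s)) \<longleftrightarrow> p (?q r) < p (?q s)"
      using ord by blast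
    then show "\<pi> (i (?q r)) < \<pi> (i (?q s))"
      unfolding permutes_inverses(1)[OF assms] using rs(3) by blast
  qed
  moreover have "strict_mono_on {1..k} j"
    using gap_enum_less[OF j] by (auto intro!: strict_mono_onI)
  moreover have "(\<lambda>s. \<pi> (i (?q s))) ` {1..k} = j ` {1..k}"
    using img image_image[of "\<lambda>t. \<pi> (i t)" ?q "{1..k}"] unfolding permutes_image[OF q] by argo
  ultimately have eq: "\<pi> (i (?q s)) = j s" if "s \<in> {1..k}" for s
    using that by (rule strict_mono_on_image_eqD)
  have "\<pi> (i t) = j (p t)" if "t \<in> {1..k}" for t
    using eq[of "p t"] that unfolding permutes_in_image[OF assms] permutes_inverses(2)[OF assms] .
  with i j show "\<exists>i j. gap_enum n k X i \<and> gap_enum n k Y j \<and> (\<forall>t\<in>{1..k}. \<pi> (i t) = j (p t))"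
    by blast
next
  assume "\<exists>i j. gap_enum n k X i \<and> gap_enum n k Y j \<and> (\<forall>t\<in>{1..k}. \<pi> (i t) = j (p t))"
  then obtain i j where i: "gap_enum n k X i" and j: "gap_enum n k Y j"
    and eq: "\<forall>t\<in>{1..k}. \<pi> (i t) = j (p t)"
    by blast
  have "\<pi> (i s) < \<pi> (i t) \<longleftrightarrow> p s < p t" if "s \<in> {1..k}" "t \<in> {1..k}" for s t
    using that eq permutes_in_image[OF assms, of s] permutes_in_image[OF assms, of t]
      gap_enum_less_iff[OF j, of "p s" "p t"] by auto
  moreover have "(\<lambda>t. \<pi> (i t)) ` {1..k} = j ` {1..k}"
    using eq image_image[of j p "{1..k}"] unfolding permutes_image[OF assms]
    by (simp cong: image_cong_simp)
  ultimately show "matches n k (p, X, Y) \<pi>"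
    using i j unfolding matches_def occurrence_iff_gap_enum by blast
qed

section \<open>The symmetries as involutions\<close>

lemma permutes_atLeastAtMost_flip:
  "(\<lambda>t. if t \<in> {1..n} then n + 1 - t else t) permutes {1..n}" for n :: nat
  by (rule bij_imp_permutes, rule bij_betw_byWitness[where f' = "\<lambda>t. n + 1 - t"]) auto

lemma sym_perm_in_perms:
  assumes "\<pi> \<in> perms n"
  shows "sym_perm n s \<pi> \<in> perms n"
proof -
  let ?w = "\<lambda>t. if t \<in> {1..n} then n + 1 - t else t"
  have \<pi>: "\<pi> permutes {1..n}"
    using assms by (simp add: perms_def)
  \<comment> \<open>Reversal reflects the argument and complement the value; outside
    \<open>{1..n}\<close> everything is fixed.\<close>
  have "perm_rev n \<pi> = \<pi> \<circ> ?w" "perm_compl n \<pi> = ?w \<circ> \<pi>"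
    using permutes_not_in[OF \<pi>] permutes_in_image[OF \<pi>]
    by (auto simp: perm_rev_def perm_compl_def fun_eq_iff)
  then show ?thesis
    using \<pi> permutes_compose[OF permutes_atLeastAtMost_flip \<pi>]
      permutes_compose[OF \<pi> permutes_atLeastAtMost_flip] permutes_inv[OF \<pi>]
    by (cases s) (auto simp: perms_def)
qed

lemma sym_perm_involution:
  assumes "\<pi> \<in> perms n"
  shows "sym_perm n s (sym_perm n s \<pi>) = \<pi>"
proof -
  have \<pi>: "\<pi> permutes {1..n}"
    using assms by (simp add: perms_def)
  have "n + 1 - (n + 1 - \<pi> t) = \<pi> t" if "t \<in> {1..n}" for t
    using permutes_in_image[OF \<pi>, of t] that by auto
  then show ?thesis
    using permutes_not_in[OF \<pi>] permutes_inv_inv[OF \<pi>]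
    by (cases s) (auto simp: perm_rev_def perm_compl_def fun_eq_iff)
qed

lemma bivincular_pattern_sym:
  assumes "bivincular_pattern k P"
  shows "bivincular_pattern k (sym_pattern k s P)"
proof (cases P)
  case (fields p X Y)
  then show ?thesis
    using assms sym_perm_in_perms[of p k s] by (cases s) auto
qed

lemma sym_pattern_involution:
  assumes "bivincular_pattern k P"
  shows "sym_pattern k s (sym_pattern k s P) = P"
proof (cases P)
  case (fields p X Y)
  \<comment> \<open>The bound by \<open>k\<close> makes truncated subtraction self-inverse on the
    adjacency sets.\<close>
  have "(\<lambda>m. k - m) ` (\<lambda>m. k - m) ` Z = Z" if "Z \<subseteq> {0..k}" for Z
  proof -
    have "(\<lambda>m. k - (k - m)) ` Z = id ` Z"
      by (rule image_cong) (use that in auto)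
    then show ?thesis
      by (simp add: image_image)
  qed
  then show ?thesis
    using fields assms sym_perm_involution[of p k s] by (cases s) auto
qed

section \<open>Invariance of matching\<close>

lemma matches_sym:
  assumes P: "bivincular_pattern k P" and \<pi>: "\<pi> \<in> perms n" and m: "matches n k P \<pi>"
  shows "matches n k (sym_pattern k s P) (sym_perm n s \<pi>)"
proof (cases P)
  case (fields p X Y)
  have p: "p \<in> perms k" and X: "X \<subseteq> {0..k}" and Y: "Y \<subseteq> {0..k}"
    using P fields by auto
  have p': "p permutes {1..k}"
    using p by (simp add: perms_def)
  have \<pi>': "\<pi> permutes {1..n}"
    using \<pi> by (simp add: perms_def)
  have sp: "sym_perm k s p permutes {1..k}"
    using sym_perm_in_perms[OF p] by (simp add: perms_def)
  obtain i j where i: "gap_enum n k X i" and j: "gap_enum n k Y j"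
    and eq: "\<And>t. t \<in> {1..k} \<Longrightarrow> \<pi> (i t) = j (p t)"
    using m unfolding fields matches_iff[OF p'] by blast
  show ?thesis
  proof (cases s)
    case Reverse
    \<comment> \<open>The reversal undoes the outer reflection of the position, leaving the old
      equation at index \<open>k + 1 - t\<close>.\<close>
    have "perm_rev n \<pi> (n + 1 - i (k + 1 - t)) = j (perm_rev k p t)" if "t \<in> {1..k}" for t
    proof -
      have t: "k + 1 - t \<in> {1..k}"
        using that by auto
      show ?thesis
        using gap_enum_in_range[OF i t] eq[OF t] that by (auto simp: perm_rev_def)
    qed
    then show ?thesis
      using gap_enum_flip[OF i X] j sp
      unfolding fields Reverse sym_pattern.simps sym_perm.simps by (subst matches_iff) blast+
  next
    case Complement
    \<comment> \<open>Complementing \<open>p\<close> cancels the inner reflection of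
      \<open>j\<close>, so its index is again \<open>p t\<close>.\<close>
    have "perm_compl n \<pi> (i t) = n + 1 - j (k + 1 - perm_compl k p t)" if t: "t \<in> {1..k}" for t
    proof -
      have "k + 1 - (k + 1 - p t) = p t"
        using permutes_in_image[OF p', of t] t by auto
      then show ?thesis
        using gap_enum_in_range[OF i t] eq[OF t] t by (simp add: perm_compl_def)
    qed
    then show ?thesis
      using gap_enum_flip[OF j Y] i sp
      unfolding fields Complement sym_pattern.simps sym_perm.simps by (subst matches_iff) blast+
  next
    case Inverse
    \<comment> \<open>The old equation at \<open>inv p t\<close>, solved for the position.\<close>
    have "inv \<pi> (j t) = i (inv p t)" if t: "t \<in> {1..k}" for t
    proof -
      have "inv p t \<in> {1..k}"
        using permutes_in_image[OF permutes_inv[OF p']] t by blast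
      then have "\<pi> (i (inv p t)) = j t"
        using eq permutes_inverses(1)[OF p'] by metis
      then show ?thesis
        using permutes_inverses(2)[OF \<pi>'] by metis
    qed
    then show ?thesis
      using i j sp
      unfolding fields Inverse sym_pattern.simps sym_perm.simps by (subst matches_iff) blast+
  qed
qed

text \<open>The converse applies \<open>matches_sym\<close> to the images, since the symmetry is an
  involution on both patterns and permutations.\<close>

lemma matches_sym_iff:
  assumes "bivincular_pattern k P" "\<pi> \<in> perms n"
  shows "matches n k (sym_pattern k s P) (sym_perm n s \<pi>) \<longleftrightarrow> matches n k P \<pi>"
  using matches_sym[OF assms, of s]
    matches_sym[OF bivincular_pattern_sym[OF assms(1)] sym_perm_in_perms[OF assms(2)], of s s s]
  by (auto simp: sym_pattern_involution[OF assms(1)] sym_perm_involution[OF assms(2)])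

text \<open>The induction generalizes over \<open>P\<close> and \<open>\<pi>\<close>, because the
  head of the list acts first and changes both.\<close>

lemma matches_op_iff:
  assumes "bivincular_pattern k P" "\<pi> \<in> perms n"
  shows "matches n k (op_pattern a k P) (op_perm a n \<pi>) \<longleftrightarrow> matches n k P \<pi>"
  using assms
  by (induction a arbitrary: P \<pi>)
    (simp_all add: op_perm_def op_pattern_def matches_sym_iff bivincular_pattern_sym
      sym_perm_in_perms)

lemma bij_betw_sym_perm: "bij_betw (sym_perm n s) (perms n) (perms n)"
  by (rule bij_betw_byWitness[where f' = "sym_perm n s"])
    (auto simp: sym_perm_in_perms sym_perm_involution)

text \<open>A composition may fail to be an involution, so bijectivity is obtained factor by
  factor.\<close>

lemma bij_betw_op_perm: "bij_betw (op_perm a n) (perms n) (perms n)"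
proof (induction a)
  case Nil
  show ?case
    by (simp add: op_perm_def bij_betw_def)
next
  case (Cons s a)
  have "op_perm (s # a) n = op_perm a n \<circ> sym_perm n s"
    by (simp add: op_perm_def fun_eq_iff)
  then show ?case
    using bij_betw_trans[OF bij_betw_sym_perm Cons.IH] by (simp only:)
qed

section \<open>Transport of avoidance and matching classes\<close>

text \<open>A common form of both classes, so that each transport argument is made once.\<close>

definition stable_part :: "'a set \<Rightarrow> ('a \<times> 'a) set \<Rightarrow> ('a \<Rightarrow> bool) \<Rightarrow> 'a set" where
  "stable_part S r Q = {x \<in> S. Q x \<and> (\<forall>y\<in>S. (x, y) \<in> r \<longrightarrow> Q y)}"

lemma avoid_class_eq: "avoid_class R n k P = stable_part (perms n) (R n) (avoids n k P)"
  by (simp add: avoid_class_def stable_part_def)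

lemma match_class_eq: "match_class R n k P = stable_part (perms n) (R n) (matches n k P)"
  by (simp add: match_class_def stable_part_def)

text \<open>By surjectivity anything related to \<open>f x\<close> is some \<open>f z\<close>;
  reflecting the relation gives \<open>z\<close> related to \<open>x\<close>, so \<open>Q z\<close>
  and hence \<open>Q' (f z)\<close>. Separate sets and relations allow reuse for the inverse
  map.\<close>

lemma image_stable_part_subset:
  assumes "f ` S = T"
    and "\<And>x. x \<in> S \<Longrightarrow> Q' (f x) \<longleftrightarrow> Q x"
    and "\<And>x y. x \<in> S \<Longrightarrow> y \<in> S \<Longrightarrow> (f x, f y) \<in> r' \<Longrightarrow> (x, y) \<in> r"
  shows "f ` stable_part S r Q \<subseteq> stable_part T r' Q'"
proof
  fix y assume "y \<in> f ` stable_part S r Q"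
  then obtain x where x: "x \<in> S" "Q x" "\<forall>z\<in>S. (x, z) \<in> r \<longrightarrow> Q z" and y: "y = f x"
    unfolding stable_part_def by blast
  have "Q' w" if w: "w \<in> T" "(f x, w) \<in> r'" for w
  proof -
    obtain z where z: "z \<in> S" "w = f z"
      using assms(1) w(1) by blast
    then show ?thesis
      using assms(2)[OF z(1)] assms(3)[OF x(1) z(1)] x(3) w(2) by blast
  qed
  then show "y \<in> stable_part T r' Q'"
    using assms(1) assms(2)[OF x(1)] x y unfolding stable_part_def by blast
qed

text \<open>The inverse reflects the relation exactly because \<open>f\<close> preserves it, so the
  preceding inclusion applies with the roles exchanged.\<close>

lemma inv_into_image_stable_part_subset:
  assumes f: "bij_betw f S T"
    and Q: "\<And>x. x \<in> S \<Longrightarrow> Q' (f x) \<longleftrightarrow> Q x"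
    and r: "\<And>x y. x \<in> S \<Longrightarrow> y \<in> S \<Longrightarrow> (x, y) \<in> r \<Longrightarrow> (f x, f y) \<in> r'"
  shows "inv_into S f ` stable_part T r' Q' \<subseteq> stable_part S r Q"
proof (rule image_stable_part_subset)
  have inv: "inv_into S f y \<in> S" "f (inv_into S f y) = y" if "y \<in> T" for y
    using bij_betwE[OF bij_betw_inv_into[OF f]] bij_betw_inv_into_right[OF f] that by auto
  show "inv_into S f ` T = S"
    using f by (intro bij_betw_imp_surj_on bij_betw_inv_into)
  show "Q (inv_into S f y) \<longleftrightarrow> Q' y" if "y \<in> T" for y
    using Q[OF inv(1)[OF that]] inv(2)[OF that] by simp
  show "(y, z) \<in> r'" if "y \<in> T" "z \<in> T" "(inv_into S f y, inv_into S f z) \<in> r" for y z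
    using r[OF inv(1)[OF that(1)] inv(1)[OF that(2)] that(3)]
    unfolding inv(2)[OF that(1)] inv(2)[OF that(2)] .
qed

lemma bij_betw_stable_part:
  assumes f: "bij_betw f S T"
    and Q: "\<And>x. x \<in> S \<Longrightarrow> Q' (f x) \<longleftrightarrow> Q x"
    and r: "\<And>x y. x \<in> S \<Longrightarrow> y \<in> S \<Longrightarrow> (x, y) \<in> r \<longleftrightarrow> (f x, f y) \<in> r'"
  shows "bij_betw f (stable_part S r Q) (stable_part T r' Q')"
proof (rule bij_betw_byWitness[where f' = "inv_into S f"])
  show "\<forall>x\<in>stable_part S r Q. inv_into S f (f x) = x"
    using bij_betw_inv_into_left[OF f] by (auto simp: stable_part_def)
  show "\<forall>y\<in>stable_part T r' Q'. f (inv_into S f y) = y"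
    using bij_betw_inv_into_right[OF f] by (auto simp: stable_part_def)
  show "f ` stable_part S r Q \<subseteq> stable_part T r' Q'"
    by (rule image_stable_part_subset[OF bij_betw_imp_surj_on[OF f]]) (simp_all add: Q r)
  show "inv_into S f ` stable_part T r' Q' \<subseteq> stable_part S r Q"
    by (rule inv_into_image_stable_part_subset[OF f]) (simp_all add: Q r)
qed

theorem proposition2p5:
  fixes R :: perm_rel and a :: "symmetry list" and k n :: nat and P :: pattern
  assumes "\<And>m. equiv (perms m) (R m)"
    and "a \<noteq> []"
    and "bivincular_pattern k P"
  shows
    "((\<forall>m. \<forall>\<pi>\<in>perms m. \<forall>\<mu>\<in>perms m.
          (op_perm a m \<pi>, op_perm a m \<mu>) \<in> R m \<longrightarrow> (\<pi>, \<mu>) \<in> R m) \<longrightarrow>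
        op_perm a n ` avoid_class R n k P \<subseteq> avoid_class R n k (op_pattern a k P) \<and>
        inj_on (op_perm a n) (avoid_class R n k P) \<and>
        op_perm a n ` match_class R n k P \<subseteq> match_class R n k (op_pattern a k P) \<and>
        inj_on (op_perm a n) (match_class R n k P))
     \<and>
     ((\<forall>m. \<forall>\<pi>\<in>perms m. \<forall>\<mu>\<in>perms m.
          (\<pi>, \<mu>) \<in> R m \<longrightarrow> (op_perm a m \<pi>, op_perm a m \<mu>) \<in> R m) \<longrightarrow>
        bij_betw (op_perm a n) (perms n) (perms n) \<and>
        inv_into (perms n) (op_perm a n) ` avoid_class R n k (op_pattern a k P)
          \<subseteq> avoid_class R n k P \<and>
        inj_on (inv_into (perms n) (op_perm a n)) (avoid_class R n k (op_pattern a k P)) \<and>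
        inv_into (perms n) (op_perm a n) ` match_class R n k (op_pattern a k P)
          \<subseteq> match_class R n k P \<and>
        inj_on (inv_into (perms n) (op_perm a n)) (match_class R n k (op_pattern a k P)))
     \<and>
     ((\<forall>m. \<forall>\<pi>\<in>perms m. \<forall>\<mu>\<in>perms m.
          (\<pi>, \<mu>) \<in> R m \<longleftrightarrow> (op_perm a m \<pi>, op_perm a m \<mu>) \<in> R m) \<longrightarrow>
        bij_betw (op_perm a n) (avoid_class R n k P) (avoid_class R n k (op_pattern a k P)) \<and>
        bij_betw (op_perm a n) (match_class R n k P) (match_class R n k (op_pattern a k P)))"
proof -
  let ?f = "op_perm a n"
  have bij: "bij_betw ?f (perms n) (perms n)"
    by (rule bij_betw_op_perm)
  have M: "matches n k (op_pattern a k P) (?f \<pi>) \<longleftrightarrow> matches n k P \<pi>" if "\<pi> \<in> perms n" for \<pi>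
    using assms(3) that by (rule matches_op_iff)
  then have A: "avoids n k (op_pattern a k P) (?f \<pi>) \<longleftrightarrow> avoids n k P \<pi>" if "\<pi> \<in> perms n" for \<pi>
    using that by (simp add: avoids_def)
  have inj: "inj_on ?f (stable_part (perms n) (R n) Q)" for Q
    using bij by (auto simp: bij_betw_def stable_part_def intro: inj_on_subset)
  have inj_inv: "inj_on (inv_into (perms n) ?f) (stable_part (perms n) (R n) Q)" for Q
    using bij_betw_inv_into[OF bij]
    by (auto simp: bij_betw_def stable_part_def intro: inj_on_subset)
  show ?thesis
    unfolding avoid_class_eq match_class_eq
    \<comment> \<open>The three parts use reflection, preservation and both together; the hypotheses
      on \<open>R\<close> are taken at size \<open>n\<close>.\<close>
    by (intro conjI impI inj inj_inv bij image_stable_part_subset inv_into_image_stable_part_subset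
        bij_betw_stable_part bij_betw_imp_surj_on[OF bij] M A) blast+
qed

end
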